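(* Let $h=h(x,u)$ be a smooth function defined for all $x$ in a neighborhood of $\mathbb{S}^2$ in $\mathbb{R}^3$ and all $u\in\mathbb{R}$, and consider the associated gradient flux vector $F(x,u)=n(x)\times\nabla_x h(x,u)$, $x\in\mathbb{S}^2$, $u\in\mathbb{R}$. Let $H=H(x)$ be a smooth function defined in a neighborhood of $\mathbb{S}^2$, and suppose that the function $u_0:\mathbb{S}^2\to\mathbb{R}$ satisfies $$\nabla_y h(y,u_0(x))\big|_{y=x}=\nabla_x H(x)\qquad\text{for all }x\in\mathbb{S}^2 .$$ Then $u_0$ is a stationary solution to the conservation law $\frac{\partial u}{\partial t}+\nabla_T\cdot\big(F(x,u)\big)=0$ on $\mathbb{S}^2$.
   Context: $\mathbb{S}^2$ is the unit sphere in $\mathbb{R}^3$, $n(x)=x$ is the outward unit normal at $x\in\mathbb{S}^2$, $\times$ is the cross product in $\mathbb{R}^3$, $\nabla_x,\nabla_y$ denote Euclidean gradients in $\mathbb{R}^3$ (in the first argument of $h$, with the second argument held fixed), and $\nabla_T\cdot$ is the tangential (Riemannian) divergence of tangent vector fields on $\mathbb{S}^2$ with the round metric. A function $u_0:\mathbb{S}^2\to\mathbb{R}$ is called a stationary solution (steady state) of the conservation law $\partial_t u+\nabla_T\cdot(F(x,u))=0$ if $\nabla_T\cdot\big(F(x,u_0(x))\big)\equiv 0$ on $\mathbb{S}^2$, where the divergence is that of the tangent vector field $x\mapsto F(x,u_0(x))$. *)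

theory Defs
  imports "HOL-Analysis.Analysis"
begin

text \<open>\<open>C_k_on k f S\<close> is meant for open \<open>S\<close> in a finite-dimensional space, where
  \<open>C\<^sup>k\<close> is equivalent to all iterated directional derivatives of order up to \<open>k\<close> existing as
  derivatives of Frechet differentiable functions and being continuous.\<close>

primrec C_k_on :: "nat \<Rightarrow> ('a::real_normed_vector \<Rightarrow> 'b::real_normed_vector) \<Rightarrow> 'a set \<Rightarrow> bool" where
  "C_k_on 0 f S \<longleftrightarrow> continuous_on S f"
| "C_k_on (Suc k) f S \<longleftrightarrow>
     (\<forall>x\<in>S. f differentiable (at x)) \<and> (\<forall>v. C_k_on k (\<lambda>x. frechet_derivative f (at x) v) S)"

definition smooth_on :: "('a::real_normed_vector \<Rightarrow> 'b::real_normed_vector) \<Rightarrow> 'a set \<Rightarrow> bool" where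
  "smooth_on f S \<longleftrightarrow> (\<forall>k. C_k_on k f S)"

definition grad :: "('a::real_inner \<Rightarrow> real) \<Rightarrow> 'a \<Rightarrow> 'a" where
  "grad f x = (THE g. GDERIV f x :> g)"

lemma grad_eqI: "GDERIV f x :> g \<Longrightarrow> grad f x = g"
  unfolding grad_def
proof (rule the_equality)
  fix g' assume "GDERIV f x :> g'" and "GDERIV f x :> g"
  then have "(\<lambda>h. h \<bullet> g') = (\<lambda>h. h \<bullet> g)"
    unfolding gderiv_def by (rule has_derivative_unique)
  then show "g' = g" by (metis inner_commute vector_eq_rdot)
qed

abbreviation S2 :: "(real^3) set" where "S2 \<equiv> sphere 0 1"

definition outward_normal :: "real^3 \<Rightarrow> real^3" where
  "outward_normal x = x"

definition tangent_proj :: "real^3 \<Rightarrow> real^3 \<Rightarrow> real^3" where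
  "tangent_proj x v = v - (v \<bullet> outward_normal x) *\<^sub>R outward_normal x"

text \<open>The Levi-Civita connection of the round metric is the tangential part of the ambient
  derivative.  \<open>A\<close> is the endomorphism \<open>v \<mapsto> \<nabla>\<^sub>v V\<close> of the tangent plane at \<open>x\<close>, extended by \<open>0\<close> on
  the normal line so that it is an endomorphism of \<open>\<real>\<^sup>3\<close> with the same trace.  The derivative is
  taken within the sphere, so only the values of \<open>V\<close> there matter; \<open>D\<close> itself is determined only
  on tangent vectors, but this suffices to determine \<open>A\<close>.\<close>

definition has_covariant_derivative ::
    "(real^3 \<Rightarrow> real^3) \<Rightarrow> (real^3 \<Rightarrow> real^3) \<Rightarrow> real^3 \<Rightarrow> bool" where
  "has_covariant_derivative V A x \<longleftrightarrow>
     (\<exists>D. (V has_derivative D) (at x within S2) \<and>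
          A = (\<lambda>v. tangent_proj x (D (tangent_proj x v))))"

text \<open>The Riemannian divergence \<open>\<nabla>\<^sub>T \<cdot> V\<close> of a tangent field is the trace of its covariant derivative.\<close>

definition has_tangential_divergence :: "(real^3 \<Rightarrow> real^3) \<Rightarrow> real \<Rightarrow> real^3 \<Rightarrow> bool" where
  "has_tangential_divergence V d x \<longleftrightarrow>
     (\<exists>A. has_covariant_derivative V A x \<and> d = trace (matrix A))"

lemma derivative_within_S2_unique:
  assumes x: "x \<in> S2" and v: "x \<bullet> v = 0"
    and D: "(V has_derivative D) (at x within S2)"
    and E: "(V has_derivative E) (at x within S2)"
  shows "D v = E v"
proof (cases "v = 0")
  case True
  then show ?thesis using D E by (simp add: has_derivative_bounded_linear linear_simps(3))
next
  case False
  define r where "r = norm v"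
  have r: "r \<noteq> 0" using False by (simp add: r_def)
  define c where "c t = cos (r * t) *\<^sub>R x + (sin (r * t) / r) *\<^sub>R v" for t :: real
  have xx: "x \<bullet> x = 1" using x by (simp add: norm_eq_1)
  have vv: "v \<bullet> v = r\<^sup>2" by (simp add: r_def power2_norm_eq_inner)
  have "c t \<bullet> c t = 1" for t
  proof -
    have "c t \<bullet> c t = (cos (r * t))\<^sup>2 * (x \<bullet> x) + (sin (r * t) / r)\<^sup>2 * (v \<bullet> v)"
      using v by (simp add: c_def inner_add_left inner_add_right inner_commute power2_eq_square)
    also have "\<dots> = 1" using r by (simp add: xx vv power_divide)
    finally show ?thesis .
  qed
  then have cS: "range c \<subseteq> S2" by (auto simp: norm_eq_1)
  have c0: "c 0 = x" by (simp add: c_def)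
  have c': "(c has_derivative (\<lambda>t. t *\<^sub>R v)) (at 0)"
  proof -
    have "((\<lambda>t. cos (r * t)) has_real_derivative 0) (at 0)"
      and "((\<lambda>t. sin (r * t) / r) has_real_derivative 1) (at 0)"
      using r by (auto intro!: derivative_eq_intros)
    then have "((\<lambda>t. cos (r * t) *\<^sub>R x + (sin (r * t) / r) *\<^sub>R v) has_vector_derivative
        (cos (r * 0) *\<^sub>R 0 + 0 *\<^sub>R x) + ((sin (r * 0) / r) *\<^sub>R 0 + 1 *\<^sub>R v)) (at 0)"
      by (intro has_vector_derivative_add has_vector_derivative_scaleR has_vector_derivative_const)
    then show ?thesis by (simp add: has_vector_derivative_def c_def[abs_def])
  qed
  have *: "((\<lambda>t. V (c t)) has_derivative (\<lambda>t. G (t *\<^sub>R v))) (at 0)"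
    if "(V has_derivative G) (at x within S2)" for G
  proof (rule has_derivative_in_compose[OF c'])
    show "(V has_derivative G) (at (c 0) within range c)"
      unfolding c0 using that cS by (rule has_derivative_subset)
  qed
  have "(\<lambda>t. D (t *\<^sub>R v)) = (\<lambda>t. E (t *\<^sub>R v))"
    using *[OF D] *[OF E] by (rule has_derivative_unique)
  then show ?thesis by (metis scaleR_one)
qed

lemma has_covariant_derivative_unique:
  assumes x: "x \<in> S2" and A: "has_covariant_derivative V A x"
    and B: "has_covariant_derivative V B x"
  shows "A = B"
proof -
  obtain D where D: "(V has_derivative D) (at x within S2)"
    and A: "A = (\<lambda>v. tangent_proj x (D (tangent_proj x v)))"
    using A unfolding has_covariant_derivative_def by blast
  obtain E where E: "(V has_derivative E) (at x within S2)"
    and B: "B = (\<lambda>v. tangent_proj x (E (tangent_proj x v)))"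
    using B unfolding has_covariant_derivative_def by blast
  have "x \<bullet> tangent_proj x v = 0" for v
    using x
    by (simp add: tangent_proj_def outward_normal_def inner_diff_right norm_eq_1 inner_commute)
  then have "D (tangent_proj x v) = E (tangent_proj x v)" for v
    using derivative_within_S2_unique[OF x _ D E] by blast
  then show ?thesis by (simp add: A B)
qed

lemma has_tangential_divergence_unique:
  assumes "x \<in> S2" "has_tangential_divergence V d x" "has_tangential_divergence V d' x"
  shows "d = d'"
  using assms has_covariant_derivative_unique unfolding has_tangential_divergence_def by blast

text \<open>\<open>u\<^sub>0\<close> is a stationary solution of \<open>\<partial>\<^sub>t u + \<nabla>\<^sub>T \<cdot> (F(x,u)) = 0\<close>; the vector field
  \<open>x \<mapsto> F(x,u\<^sub>0(x))\<close> is required to be differentiable, while \<open>u\<^sub>0\<close> itself need not be.\<close>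

definition stationary_solution :: "(real^3 \<Rightarrow> real \<Rightarrow> real^3) \<Rightarrow> (real^3 \<Rightarrow> real) \<Rightarrow> bool" where
  "stationary_solution F u0 \<longleftrightarrow>
     (\<forall>x\<in>S2. has_tangential_divergence (\<lambda>x. F x (u0 x)) 0 x)"

definition gradient_flux :: "(real^3 \<Rightarrow> real \<Rightarrow> real) \<Rightarrow> real^3 \<Rightarrow> real \<Rightarrow> real^3" where
  "gradient_flux h x u = cross3 (outward_normal x) (grad (\<lambda>y. h y u) x)"

end

theory Submission
  imports Defs
begin

text \<open>On the sphere the flux \<open>x \<mapsto> F(x, u\<^sub>0(x))\<close> equals \<open>V(x) = x \<times> \<nabla>H(x)\<close>, which is defined and
  differentiable on a neighbourhood and orthogonal to \<open>x\<close>.  Its ambient derivative is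
  \<open>v \<mapsto> v \<times> g + x \<times> B v\<close> with \<open>g = \<nabla>H(x)\<close> and \<open>B\<close> the Hessian of \<open>H\<close> at \<open>x\<close>.  Both summands have
  trace zero (the second because \<open>B\<close> is symmetric), and so does the normal part
  \<open>v \<mapsto> (v \<times> g \<bullet> x) x\<close> that the tangential projection removes.\<close>

text \<open>The mean value theorem in direction \<open>a\<close> turns the second difference into a difference of
  values of \<open>g \<bullet> a\<close>; so differentiability of \<open>g\<close> at the single point \<open>x\<close> suffices for the symmetry
  of the second derivative below.\<close>

lemma second_difference_limit:
  fixes f :: "'a::real_inner \<Rightarrow> real"
  assumes "open W" "x \<in> W"
    and f: "\<And>y. y \<in> W \<Longrightarrow> GDERIV f y :> g y"
    and g: "(g has_derivative B) (at x)"
  shows "((\<lambda>t. (f (x + t *\<^sub>R a + t *\<^sub>R b) - f (x + t *\<^sub>R a) - f (x + t *\<^sub>R b) + f x) / t\<^sup>2)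
           \<longlongrightarrow> a \<bullet> B b) (at_right 0)"
proof (rule tendstoI)
  fix e :: real assume "e > 0"
  \<comment> \<open>For \<open>0 \<le> s, r \<le> t\<close> the displacement
    \<open>s *\<^sub>R a + r *\<^sub>R b\<close> has norm at most \<open>t * M\<close>. The summand
    1 keeps \<open>M\<close> positive when \<open>a\<close> and \<open>b\<close> both vanish, so
    that dividing by \<open>M\<close> is safe.\<close>
  define M where "M = norm a + norm b + 1"
  have M: "M > 0" by (simp add: M_def add_nonneg_pos)
  have lin: "linear B" using g by (rule has_derivative_linear)
  define L where "L v = a \<bullet> B v" for v
  have Ladd: "L (v + w) = L v + L w" and Lscale: "L (c *\<^sub>R v) = c * L v" for v w c
    using lin by (simp_all add: L_def linear_add linear_scale inner_add_right)
  have "((\<lambda>y. a \<bullet> g y) has_derivative L) (at x)"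
    unfolding L_def using g by (rule has_derivative_inner_right)
  \<comment> \<open>With this tolerance the linearization of \<open>a \<bullet> g\<close> errs by at
    most \<open>e * t / 4\<close> at each point of the parallelogram. Two such errors enter, and
    division by \<open>t\<close> leaves \<open>e / 2 < e\<close>.\<close>
  moreover have "e / (4 * M) > 0" using \<open>e > 0\<close> M by simp
  ultimately obtain d1 where "d1 > 0" and d1: "\<And>y. norm (y - x) < d1 \<Longrightarrow>
      norm (a \<bullet> g y - a \<bullet> g x - L (y - x)) \<le> e / (4 * M) * norm (y - x)"
    unfolding has_derivative_at_alt by blast
  obtain d2 where "d2 > 0" and d2: "ball x d2 \<subseteq> W"
    using assms(1,2) open_contains_ball by blast
  define d where "d = min d1 d2"
  have d: "d > 0" "d \<le> d1" "d \<le> d2" using \<open>d1 > 0\<close> \<open>d2 > 0\<close> by (auto simp: d_def)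
  have "dist ((f (x + t *\<^sub>R a + t *\<^sub>R b) - f (x + t *\<^sub>R a) - f (x + t *\<^sub>R b) + f x) / t\<^sup>2) (L b) < e"
    if t: "0 < t" "t < d / M" for t
  proof -
    have tM: "t * M < d" using t M by (simp add: field_simps)
    have small: "norm (s *\<^sub>R a + r *\<^sub>R b) \<le> t * M" if "0 \<le> s" "s \<le> t" "0 \<le> r" "r \<le> t" for s r
    proof -
      have "norm (s *\<^sub>R a + r *\<^sub>R b) \<le> s * norm a + r * norm b"
        using norm_triangle_ineq[of "s *\<^sub>R a" "r *\<^sub>R b"] that by simp
      also have "\<dots> \<le> t * norm a + t * norm b"
        using that by (intro add_mono mult_right_mono) auto
      also have "\<dots> \<le> t * M" using t by (simp add: M_def algebra_simps)
      finally show ?thesis .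
    qed
    have err: "\<bar>a \<bullet> g (x + s *\<^sub>R a + r *\<^sub>R b) - a \<bullet> g x - (s * L a + r * L b)\<bar> \<le> e * t / 4"
      if "0 \<le> s" "s \<le> t" "0 \<le> r" "r \<le> t" for s r
    proof -
      let ?y = "x + s *\<^sub>R a + r *\<^sub>R b"
      have y: "norm (?y - x) \<le> t * M" using small[OF that] by (simp add: add.assoc)
      have "L (?y - x) = s * L a + r * L b" by (simp add: add.assoc Ladd Lscale)
      then have "\<bar>a \<bullet> g ?y - a \<bullet> g x - (s * L a + r * L b)\<bar> \<le> e / (4 * M) * norm (?y - x)"
        using d1[of ?y] y tM d by simp
      also have "\<dots> \<le> e / (4 * M) * (t * M)"
        using y \<open>e > 0\<close> M by (intro mult_left_mono) auto
      also have "\<dots> = e * t / 4" using M by simp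
      finally show ?thesis .
    qed
    have deriv: "((\<lambda>s. f (x + s *\<^sub>R a + r *\<^sub>R b)) has_real_derivative
        a \<bullet> g (x + s *\<^sub>R a + r *\<^sub>R b)) (at s)"
      if "0 \<le> s" "s \<le> t" "0 \<le> r" "r \<le> t" for s r
    proof -
      let ?y = "x + s *\<^sub>R a + r *\<^sub>R b"
      have "norm (?y - x) < d" using small[OF that] tM by (simp add: add.assoc)
      then have "dist ?y x < d2" unfolding dist_norm using d by simp
      then have "?y \<in> W" using d2 by (metis mem_ball dist_commute subsetD)
      then have "(f has_derivative (\<lambda>h. h \<bullet> g ?y)) (at ?y)"
        using f by (simp add: gderiv_def)
      moreover have "((\<lambda>s. x + s *\<^sub>R a + r *\<^sub>R b) has_derivative (\<lambda>h. h *\<^sub>R a)) (at s)"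
        by (auto intro!: derivative_eq_intros)
      ultimately have "((\<lambda>s. f (x + s *\<^sub>R a + r *\<^sub>R b)) has_derivative (\<lambda>h. (h *\<^sub>R a) \<bullet> g ?y)) (at s)"
        by (rule has_derivative_compose[rotated])
      then show ?thesis
        by (rule has_derivative_imp_has_field_derivative) simp
    qed
    \<comment> \<open>The second difference is the increment of \<open>\<phi>\<close> over
      \<open>[0, t]\<close>, so the mean value theorem applies to it as a function of one
      variable.\<close>
    define \<phi> where "\<phi> s = f (x + s *\<^sub>R a + t *\<^sub>R b) - f (x + s *\<^sub>R a)" for s
    have "(\<phi> has_real_derivative a \<bullet> g (x + s *\<^sub>R a + t *\<^sub>R b) - a \<bullet> g (x + s *\<^sub>R a)) (at s)"
      if "0 \<le> s" "s \<le> t" for s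
      unfolding \<phi>_def using DERIV_diff[OF deriv[of s t] deriv[of s 0]] that t by simp
    from MVT2[OF t(1) this] obtain s where s: "0 < s" "s < t"
      and "\<phi> t - \<phi> 0 = (t - 0) * (a \<bullet> g (x + s *\<^sub>R a + t *\<^sub>R b) - a \<bullet> g (x + s *\<^sub>R a))"
      by blast
    then have "(\<phi> t - \<phi> 0) / t\<^sup>2 = (a \<bullet> g (x + s *\<^sub>R a + t *\<^sub>R b) - a \<bullet> g (x + s *\<^sub>R a)) / t"
      using t by (simp add: power2_eq_square)
    \<comment> \<open>Used with \<open>r = a \<bullet> g x\<close>, \<open>v = s * L a\<close>,
      \<open>w = t * L b\<close>: the unknown intermediate point \<open>s\<close> enters both
      linearizations through the same term \<open>s * L a\<close>, which cancels.\<close>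
    moreover have "\<bar>p - q - w\<bar> \<le> c / 2"
      if "\<bar>p - r - (v + w)\<bar> \<le> c / 4" "\<bar>q - r - v\<bar> \<le> c / 4" for p q r v w c :: real
      using that by linarith
    then have "\<bar>a \<bullet> g (x + s *\<^sub>R a + t *\<^sub>R b) - a \<bullet> g (x + s *\<^sub>R a) - t * L b\<bar> \<le> e * t / 2"
      using err[of s t] err[of s 0] s t by fastforce
    then have "\<bar>(a \<bullet> g (x + s *\<^sub>R a + t *\<^sub>R b) - a \<bullet> g (x + s *\<^sub>R a)) / t - L b\<bar> \<le> e / 2"
      using t by (simp add: abs_le_iff field_simps)
    ultimately have "\<bar>(\<phi> t - \<phi> 0) / t\<^sup>2 - L b\<bar> < e" using \<open>e > 0\<close> by simp
    moreover have "\<phi> t - \<phi> 0 = f (x + t *\<^sub>R a + t *\<^sub>R b) - f (x + t *\<^sub>R a) - f (x + t *\<^sub>R b) + f x"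
      by (simp add: \<phi>_def)
    ultimately show ?thesis by (simp add: dist_real_def)
  qed
  moreover have "\<forall>\<^sub>F t in at_right 0. 0 < t \<and> t < d / M"
    unfolding eventually_at_right_field using d M by (intro exI[of _ "d / M"]) simp
  ultimately show "\<forall>\<^sub>F t in at_right 0.
      dist ((f (x + t *\<^sub>R a + t *\<^sub>R b) - f (x + t *\<^sub>R a) - f (x + t *\<^sub>R b) + f x) / t\<^sup>2) (a \<bullet> B b) < e"
    unfolding L_def by (auto elim!: eventually_mono)
qed

text \<open>The second difference is invariant under exchanging \<open>a\<close> and
  \<open>b\<close>, so its two limits coincide.\<close>

lemma derivative_of_gradient_symmetric:
  fixes f :: "'a::real_inner \<Rightarrow> real"
  assumes "open W" "x \<in> W"
    and "\<And>y. y \<in> W \<Longrightarrow> GDERIV f y :> g y"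
    and "(g has_derivative B) (at x)"
  shows "a \<bullet> B b = b \<bullet> B a"
proof (rule tendsto_unique)
  show "((\<lambda>t. (f (x + t *\<^sub>R a + t *\<^sub>R b) - f (x + t *\<^sub>R a) - f (x + t *\<^sub>R b) + f x) / t\<^sup>2)
           \<longlongrightarrow> a \<bullet> B b) (at_right 0)"
    using assms by (rule second_difference_limit)
  show "((\<lambda>t. (f (x + t *\<^sub>R a + t *\<^sub>R b) - f (x + t *\<^sub>R a) - f (x + t *\<^sub>R b) + f x) / t\<^sup>2)
           \<longlongrightarrow> b \<bullet> B a) (at_right 0)"
    using second_difference_limit[OF assms, of b a] by (simp add: algebra_simps)
qed simp

text \<open>Riesz representation in an orthonormal basis. The explicit sum expresses the gradient
  through directional derivatives, the quantities that \<open>C_k_on\<close> controls.\<close>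

lemma GDERIV_frechet_derivative:
  fixes f :: "'a::euclidean_space \<Rightarrow> real"
  assumes "f differentiable (at x)"
  shows "GDERIV f x :> (\<Sum>b\<in>Basis. frechet_derivative f (at x) b *\<^sub>R b)"
proof -
  let ?D = "frechet_derivative f (at x)"
  have D: "(f has_derivative ?D) (at x)" using assms frechet_derivative_works by blast
  then have lin: "linear ?D" by (rule has_derivative_linear)
  have "?D h = h \<bullet> (\<Sum>b\<in>Basis. ?D b *\<^sub>R b)" for h
  proof -
    have "?D h = ?D (\<Sum>b\<in>Basis. (h \<bullet> b) *\<^sub>R b)" by (simp add: euclidean_representation)
    also have "\<dots> = (\<Sum>b\<in>Basis. (h \<bullet> b) * ?D b)"
      using lin by (simp add: linear_sum linear_scale)
    also have "\<dots> = h \<bullet> (\<Sum>b\<in>Basis. ?D b *\<^sub>R b)"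
      by (simp add: inner_sum_right mult.commute)
    finally show ?thesis .
  qed
  then have "?D = (\<lambda>h. h \<bullet> (\<Sum>b\<in>Basis. ?D b *\<^sub>R b))" by blast
  then show ?thesis using D unfolding gderiv_def by simp
qed

lemma GDERIV_grad:
  fixes f :: "'a::euclidean_space \<Rightarrow> real"
  shows "f differentiable (at x) \<Longrightarrow> GDERIV f x :> grad f x"
  using GDERIV_frechet_derivative grad_eqI by metis

text \<open>On the open set \<open>W\<close> the gradient agrees with the basis sum of directional
  derivatives, each of which is differentiable at \<open>x\<close> by
  \<open>C_k_on 2\<close>.\<close>

lemma grad_differentiable:
  fixes f :: "'a::euclidean_space \<Rightarrow> real"
  assumes "open W" "x \<in> W" and f: "C_k_on 2 f W"
  shows "grad f differentiable (at x)"
proof -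
  have f1: "f differentiable (at y)" if "y \<in> W" for y
    using f that by (simp add: numeral_2_eq_2)
  have f2: "(\<lambda>y. frechet_derivative f (at y) v) differentiable (at x)" for v
    using f \<open>x \<in> W\<close> by (simp add: numeral_2_eq_2)
  have "(\<lambda>y. \<Sum>b\<in>Basis. frechet_derivative f (at y) b *\<^sub>R b) differentiable (at x)"
    using f2 by (intro differentiable_sum differentiable_scaleR) auto
  then obtain D where
    "((\<lambda>y. \<Sum>b\<in>Basis. frechet_derivative f (at y) b *\<^sub>R b) has_derivative D) (at x)"
    unfolding differentiable_def by blast
  then have "(grad f has_derivative D) (at x)"
    by (rule has_derivative_transform_within_open[OF _ assms(1,2)])
      (simp add: grad_eqI[OF GDERIV_frechet_derivative] f1)
  then show ?thesis unfolding differentiable_def by blast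
qed

text \<open>With P the tangential projection, cyclicity of the trace and PP = P give tr(PDP) =
  tr(DP). Here DP differs from D by the rank-one map
  \<open>v \<mapsto> (v \<bullet> x) *\<^sub>R D x\<close>, whose trace is
  \<open>x \<bullet> D x\<close>.\<close>

lemma trace_tangential_part:
  assumes "x \<in> S2" and "linear D"
  shows "trace (matrix (\<lambda>v. tangent_proj x (D (tangent_proj x v))))
       = trace (matrix D) - x \<bullet> D x"
proof -
  let ?P = "tangent_proj x"
  have xx: "x \<bullet> x = 1" using assms by (simp add: norm_eq_1)
  have lin: "linear ?P"
    by (rule linearI) (simp_all add: tangent_proj_def inner_add_left algebra_simps)
  have PP: "?P \<circ> ?P = ?P"
    by (simp add: fun_eq_iff tangent_proj_def outward_normal_def inner_diff_left xx)
  have linD: "linear (D \<circ> ?P)" using lin assms(2) by (rule linear_compose)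
  have "trace (matrix (\<lambda>v. ?P (D (?P v)))) = trace (matrix (?P \<circ> (D \<circ> ?P)))"
    by (simp add: o_def)
  also have "\<dots> = trace (matrix (D \<circ> ?P) ** matrix ?P)"
    unfolding matrix_compose[OF linD lin] by (rule trace_mul_sym)
  also have "\<dots> = trace (matrix (D \<circ> (?P \<circ> ?P)))"
    unfolding matrix_compose[OF lin linD, symmetric] o_assoc ..
  also have "\<dots> = trace (matrix (\<lambda>v. D v - (v \<bullet> x) *\<^sub>R D x))"
    unfolding PP using assms(2)
    by (simp add: o_def tangent_proj_def outward_normal_def linear_diff linear_scale)
  also have "\<dots> = trace (matrix D) - x \<bullet> D x"
    by (simp add: trace_def matrix_def inner_axis' sum_subtractf inner_vec_def[of x "D x"])
  finally show ?thesis .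
qed

text \<open>In the trace of \<open>v \<mapsto> cross3 x (B v)\<close> each coordinate of
  \<open>x\<close> is multiplied by a difference of two mirrored matrix entries of \<open>B\<close>.
  The map \<open>v \<mapsto> cross3 v g\<close> has zero diagonal because \<open>cross3 v g\<close>
  is orthogonal to \<open>v\<close>.\<close>

lemma divergence_cross_symmetric:
  fixes g x :: "real^3"
  assumes "\<And>a b. a \<bullet> B b = b \<bullet> B a"
  shows "trace (matrix (\<lambda>v. cross3 x (B v) + cross3 v g)) = 0"
proof -
  have "B (axis i 1) $ j = B (axis j 1) $ i" for i j
    using assms[of "axis j 1" "axis i 1"] by (simp add: inner_axis')
  from this[of 1 2] this[of 1 3] this[of 2 3] show ?thesis
    by (simp add: trace_def matrix_def sum_3 cross_components axis_def)
qed

theorem claim3p2: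
  fixes h :: "real^3 \<Rightarrow> real \<Rightarrow> real"
    and H :: "real^3 \<Rightarrow> real"
    and u0 :: "real^3 \<Rightarrow> real"
    and U W :: "(real^3) set"
  assumes "open U" and "S2 \<subseteq> U"
    and "smooth_on (\<lambda>(x, u). h x u) (U \<times> (UNIV :: real set))"
    and "open W" and "S2 \<subseteq> W"
    and "smooth_on H W"
    and "\<forall>x\<in>S2. grad (\<lambda>y. h y (u0 x)) x = grad H x"
  shows "stationary_solution (gradient_flux h) u0"
  unfolding stationary_solution_def
proof
  fix x :: "real^3" assume x: "x \<in> S2"
  then have xW: "x \<in> W" using assms(5) by blast
  have C2: "C_k_on 2 H W" using assms(6) unfolding smooth_on_def by blast
  then have grad: "GDERIV H y :> grad H y" if "y \<in> W" for y
    using that by (intro GDERIV_grad) (simp add: numeral_2_eq_2)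
  obtain B where B: "(grad H has_derivative B) (at x)"
    using grad_differentiable[OF assms(4) xW C2] unfolding differentiable_def by blast
  have sym: "a \<bullet> B b = b \<bullet> B a" for a b
    using assms(4) xW grad B by (rule derivative_of_gradient_symmetric)
  define D where "D v = cross3 x (B v) + cross3 v (grad H x)" for v
  have "bounded_bilinear cross3"
    using bilinear_cross bilinear_conv_bounded_bilinear by blast
  from bounded_bilinear.FDERIV[OF this has_derivative_ident B]
  have "((\<lambda>y. cross3 y (grad H y)) has_derivative D) (at x)"
    unfolding D_def .
  then have "((\<lambda>y. cross3 y (grad H y)) has_derivative D) (at x within S2)"
    by (rule has_derivative_at_withinI)
  \<comment> \<open>The hypothesis on \<open>u0\<close> identifies the two fields at points of
    \<open>S2\<close>, and the derivative within \<open>S2\<close> sees only those values;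
    \<open>u0\<close> itself is never differentiated.\<close>
  then have D: "((\<lambda>y. gradient_flux h y (u0 y)) has_derivative D) (at x within S2)"
    by (rule has_derivative_transform[OF x, rotated])
      (simp add: gradient_flux_def outward_normal_def assms(7))
  have "trace (matrix D) = 0"
    unfolding D_def using sym by (rule divergence_cross_symmetric)
  \<comment> \<open>At \<open>v = x\<close> both summands of \<open>D\<close> are cross products
    with first factor \<open>x\<close>, hence orthogonal to \<open>x\<close>.\<close>
  moreover have "x \<bullet> D x = 0"
    by (simp add: D_def inner_add_right dot_cross_self)
  ultimately have "trace (matrix (\<lambda>v. tangent_proj x (D (tangent_proj x v)))) = 0"
    using trace_tangential_part[OF x has_derivative_linear[OF D]] by simp
  then show "has_tangential_divergence (\<lambda>y. gradient_flux h y (u0 y)) 0 x"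
    unfolding has_tangential_divergence_def has_covariant_derivative_def using D by metis
qed

end
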